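(* Let $-\infty<L<\infty$ and let $p:\mathbb{R}\to[0,\infty)$ be a probability density function with support $[L,\infty)$ and distribution function $P$, satisfying the following conditions. (i) $p$ is continuous and positive on $(L,\infty)$, and there are finitely many points $L<y_1<\dots<y_m<\infty$ ($m\ge 0$) such that $p$ is continuously differentiable on each component interval of $S(p)=(L,\infty)\setminus\{y_1,\dots,y_m\}$. (ii) $\sup_{x\in S(p)}\left|\frac{p'(x)\min\{P(x),1-P(x)\}}{p^2(x)}\right|<\infty$. (iii) $\int_{S(p)}(1+|x|)\,|p'(x)|\,\mathrm{d}x<\infty$. (iv) $\lim_{x\searrow L}\frac{P(x)}{p(x)}=0$. Let $X:\Omega\to(L,\infty)$ be a random variable that has a Lebesgue density, with $\mathbb{E}\left|\frac{p'(X)}{p(X)}\right|<\infty$ and $\mathbb{E}\left|\frac{p'(X)}{p(X)}X\right|<\infty$. Then $X$ has Lebesgue density $p$ if, and only if, the density function $\mathfrak{f}_X$ of $X$ (for a suitable version) satisfies $$\mathfrak{f}_X(t)=\mathbb{E}\left[-\frac{p'(X)}{p(X)}\,\mathbf{1}\{X>t\}\right],\quad t>L.$$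
   Context: $(\Omega,\mathcal{A},\mathbb{P})$ is a probability space and $\mathbf{1}\{\cdot\}$ denotes an indicator. "$X$ has Lebesgue density $p$" means that the law of $X$ is $p\,\mathcal{L}^1$, where $\mathcal{L}^1$ is Lebesgue measure on $\mathbb{R}$. $P(x)=\int_{L}^x p(s)\,\mathrm{d}s$ for $x\ge L$. The case $m=0$ is allowed. Densities are unique only up to $\mathcal{L}^1$-null sets; "for a suitable version" means that the function on the right-hand side is (on $(L,\infty)$) a density function of $X$. *)

theory Defs
  imports "HOL-Probability.Probability"
begin

definition is_pdf :: "(real \<Rightarrow> real) \<Rightarrow> bool" where
  "is_pdf p \<longleftrightarrow> (\<forall>x. 0 \<le> p x) \<and> p \<in> borel_measurable borel \<and>
     (\<integral>\<^sup>+x. ennreal (p x) \<partial>lborel) = 1"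

definition fsupp :: "(real \<Rightarrow> real) \<Rightarrow> real set" where
  "fsupp p = closure {x. p x \<noteq> 0}"

(* Nonnegativity is required separately, because ennreal maps negative reals to 0. *)
definition has_Lebesgue_density :: "'a measure \<Rightarrow> ('a \<Rightarrow> real) \<Rightarrow> (real \<Rightarrow> real) \<Rightarrow> bool" where
  "has_Lebesgue_density M X f \<longleftrightarrow>
     (\<forall>x. 0 \<le> f x) \<and> distributed M lborel X (\<lambda>x. ennreal (f x))"

definition dist_fun :: "real \<Rightarrow> (real \<Rightarrow> real) \<Rightarrow> real \<Rightarrow> real" where
  "dist_fun L p x = (LINT s:{L..x}|lborel. p s)"

definition reg_set :: "real \<Rightarrow> nat \<Rightarrow> (nat \<Rightarrow> real) \<Rightarrow> real set" where
  "reg_set L m y = {L<..} - y ` {1..m}"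

end

theory Submission
  imports Defs
begin

text \<open>
  Let \<open>\<psi> = p' / p\<close> be the logarithmic derivative of \<open>p\<close>, and let \<open>K\<close> be the finite set of exceptional
  points. If \<open>X\<close> has density \<open>f\<close>, the expectation in the theorem is an integral with respect to \<open>f\<close>
  (\<open>expectation_tail_eq_integral\<close>), so the characterizing identity is the integral equation that
  equates \<open>f t\<close>, for every \<open>t > L\<close>, with minus the integral of \<open>\<psi> f\<close> over \<open>(t, \<infinity>)\<close>.
  The integral converges because \<open>\<psi>(X)\<close> is integrable (\<open>density_integrable_of_expectation\<close>).
  The equation determines the density \<open>p\<close> for the following reason.

  If \<open>f = p\<close>, then \<open>\<psi> f = p'\<close>, and the equation is the fundamental theorem of calculus on
  \<open>[t, b]\<close> as \<open>b\<close> tends to infinity: \<open>p b\<close> converges because \<open>p'\<close> is integrable, and the limit must be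
  \<open>0\<close> because \<open>p\<close> is integrable (\<open>minus_tail_integral_deriv\<close>).

  Conversely, let a density \<open>f\<close> solve the equation. Its right-hand side is continuous in \<open>t\<close>, so \<open>f\<close> is
  continuous, hence so is \<open>\<psi> f\<close> away from \<open>K\<close>, and differentiating the equation gives
  \<open>f' = \<psi> f\<close> there. Since \<open>p\<close> solves the same linear equation, \<open>f / p\<close> has derivative \<open>0\<close> off the finite
  set \<open>K\<close>; being continuous across \<open>K\<close> it is a constant \<open>c\<close>
  (\<open>same_log_derivative_imp_proportional\<close>). Comparing total masses gives \<open>c = 1\<close>
  (\<open>density_eqI_proportional\<close>).
\<close>

section \<open>Integrals over half-lines\<close>

text \<open>
  This turns the integral over a moving half-line into a Henstock-Kurzweil integral with a moving
  upper endpoint, the form in which continuity and differentiability of indefinite integrals are known.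
\<close>

lemma tail_integral_split:
  fixes g :: "real \<Rightarrow> real"
  assumes g: "set_integrable lborel {L<..} g" and "L < a" "a \<le> t"
  shows "(LINT x:{t<..}|lborel. g x) = (LINT x:{a<..}|lborel. g x) - integral {a..t} g"
proof -
  have i1: "set_integrable lborel {a<..t} g" and i2: "set_integrable lborel {t<..} g"
    and i3: "set_integrable lborel {a..t} g"
    using assms by (auto intro!: set_integrable_subset[OF g])
  have "(LINT x:{a<..}|lborel. g x) = (LINT x:{a<..t} \<union> {t<..}|lborel. g x)"
    using \<open>a \<le> t\<close> by (simp add: ivl_disj_un)
  also have "\<dots> = (LINT x:{a<..t}|lborel. g x) + (LINT x:{t<..}|lborel. g x)"
    by (rule set_integral_Un[OF _ i1 i2]) auto
  also have "(LINT x:{a<..t}|lborel. g x) = integral {a<..t} g"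
    by (rule set_borel_integral_eq_integral(2)[OF i1])
  also have "\<dots> = integral {a..t} g"
    by (rule integral_subset_negligible[symmetric, THEN sym])
       (auto intro: negligible_subset[of "{a}"])
  finally show ?thesis by simp
qed

lemma tail_integral_continuous_on:
  fixes g :: "real \<Rightarrow> real"
  assumes g: "set_integrable lborel {L<..} g"
  shows "continuous_on {L<..} (\<lambda>t. LINT x:{t<..}|lborel. g x)"
proof (rule continuous_at_imp_continuous_on, intro ballI)
  fix t assume "t \<in> {L<..}"
  define a where "a = (L + t) / 2"
  have a: "L < a" "a < t" using \<open>t \<in> {L<..}\<close> by (auto simp: a_def)
  have "g integrable_on {a..t+1}"
    using a by (intro set_borel_integral_eq_integral set_integrable_subset[OF g]) auto
  then have "continuous_on {a..t+1} (\<lambda>t. (LINT x:{a<..}|lborel. g x) - integral {a..t} g)"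
    by (intro continuous_intros indefinite_integral_continuous_1)
  then have "continuous_on {a..t+1} (\<lambda>t. LINT x:{t<..}|lborel. g x)"
    by (rule continuous_on_eq) (use a in \<open>auto simp: tail_integral_split[OF g a(1), symmetric]\<close>)
  then show "isCont (\<lambda>t. LINT x:{t<..}|lborel. g x) t"
    by (rule continuous_on_interior) (use a in auto)
qed

lemma tail_integral_has_derivative:
  fixes g :: "real \<Rightarrow> real"
  assumes g: "set_integrable lborel {L<..} g" and t: "L < t" and gt: "isCont g t"
  shows "((\<lambda>t. LINT x:{t<..}|lborel. g x) has_real_derivative - g t) (at t)"
proof -
  define a where "a = (L + t) / 2"
  have a: "L < a" "a < t" using t by (auto simp: a_def)
  have "g integrable_on {a..t+1}"
    using a by (intro set_borel_integral_eq_integral set_integrable_subset[OF g]) auto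
  then have "((\<lambda>u. integral {a..u} g) has_vector_derivative g t) (at t within ({a..t+1} - {}))"
    using a gt by (intro integral_has_vector_derivative_continuous_at)
                  (auto intro: continuous_at_imp_continuous_at_within)
  then have "((\<lambda>u. integral {a..u} g) has_real_derivative g t) (at t)"
    using a by (simp add: has_real_derivative_iff_has_vector_derivative at_within_Icc_at)
  then have "((\<lambda>u. (LINT x:{a<..}|lborel. g x) - integral {a..u} g) has_real_derivative 0 - g t) (at t)"
    by (intro derivative_intros)
  then have "((\<lambda>u. (LINT x:{a<..}|lborel. g x) - integral {a..u} g) has_real_derivative - g t) (at t)"
    by simp
  then show ?thesis
    by (rule has_field_derivative_transform_within_open[of _ _ _ "{a<..}"])
       (use a in \<open>auto simp: tail_integral_split[OF g a(1), symmetric]\<close>)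
qed

text \<open>
  A nonzero limit \<open>l\<close> would keep \<open>u\<close> above \<open>l / 2\<close> on a half-line, which has infinite measure.
\<close>

lemma integrable_limit_at_top_zero:
  fixes u :: "real \<Rightarrow> real"
  assumes nonneg: "\<And>x. 0 \<le> u x" and fin: "(\<integral>\<^sup>+x. ennreal (u x) \<partial>lborel) < \<infinity>"
    and lim: "(u \<longlongrightarrow> l) at_top"
  shows "l = 0"
proof (rule ccontr)
  assume "l \<noteq> 0"
  moreover have "0 \<le> l"
    using lim by (rule tendsto_lowerbound) (auto simp: nonneg)
  ultimately have "l / 2 < l" "0 < l" by auto
  from order_tendstoD(1)[OF lim this(1)] obtain b where b: "\<And>x. b \<le> x \<Longrightarrow> l / 2 < u x"
    by (auto simp: eventually_at_top_linorder)
  have "(\<integral>\<^sup>+x. ennreal (l / 2) * indicator {b..} x \<partial>lborel) \<le> (\<integral>\<^sup>+x. ennreal (u x) \<partial>lborel)"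
    using b by (intro nn_integral_mono) (auto split: split_indicator intro!: ennreal_leI intro: less_imp_le)
  \<comment> \<open>The half-line contains an interval of length \<open>n\<close> for every \<open>n\<close>.\<close>
  moreover have "emeasure lborel {b..} = \<infinity>"
  proof -
    have "ennreal (real n) \<le> emeasure lborel {b..}" for n
      using emeasure_mono[of "{b..b + real n}" "{b..}" lborel] by simp
    then show ?thesis
      by (metis ennreal_of_nat_eq_real_of_nat ennreal_top_neq_zero ennreal_Ex_less_of_nat
          infinity_ennreal_def leD less_top)
  qed
  ultimately show False
    using fin \<open>0 < l\<close> by (simp add: nn_integral_cmult_indicator ennreal_mult_top)
qed

text \<open>
  The integral of \<open>u'\<close> over \<open>[t, b]\<close> is \<open>u b - u t\<close>; finitely many missing derivatives do no harm because
  \<open>u\<close> is continuous. Integrability of \<open>u'\<close> makes \<open>u b\<close> converge as \<open>b\<close> grows, and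
  integrability of \<open>u\<close> forces the limit to be \<open>0\<close>.
\<close>

lemma minus_tail_integral_deriv:
  fixes u u' :: "real \<Rightarrow> real"
  assumes nonneg: "\<And>x. 0 \<le> u x" and fin: "(\<integral>\<^sup>+x. ennreal (u x) \<partial>lborel) < \<infinity>"
    and cont: "continuous_on {L<..} u"
    and K: "finite K" and deriv: "\<And>x. x \<in> {L<..} - K \<Longrightarrow> (u has_real_derivative u' x) (at x)"
    and u': "set_integrable lborel {L<..} u'" and t: "L < t"
  shows "u t = - (LINT x:{t<..}|lborel. u' x)"
proof -
  have int: "integral {t..b} u' = u b - u t" if "t \<le> b" for b
    using that t
    by (intro integral_unique fundamental_theorem_of_calculus_interior_strong[OF K])
       (auto intro!: continuous_on_subset[OF cont] deriv
             simp: has_real_derivative_iff_has_vector_derivative[symmetric])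
  have "set_integrable lborel {t..} u'"
    by (rule set_integrable_subset[OF u']) (use t in auto)
  then have "((\<lambda>b. LINT x:{t..b}|lborel. u' x) \<longlongrightarrow> (LINT x:{t..}|lborel. u' x)) at_top"
    by (intro tendsto_set_lebesgue_integral_at_top) auto
  then have "((\<lambda>b. u t + (LINT x:{t..b}|lborel. u' x)) \<longlongrightarrow> u t + (LINT x:{t..}|lborel. u' x)) at_top"
    by (intro tendsto_intros)
  then have "(u \<longlongrightarrow> u t + (LINT x:{t..}|lborel. u' x)) at_top"
  proof (rule Lim_transform_eventually)
    show "\<forall>\<^sub>F b in at_top. u t + (LINT x:{t..b}|lborel. u' x) = u b"
      using eventually_ge_at_top[of t]
    proof eventually_elim
      case (elim b)
      have "set_integrable lborel {t..b} u'"
        by (rule set_integrable_subset[OF u']) (use t in auto)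
      from set_borel_integral_eq_integral(2)[OF this] int[OF elim] show ?case by simp
    qed
  qed
  then have "u t + (LINT x:{t..}|lborel. u' x) = 0"
    by (rule integrable_limit_at_top_zero[OF nonneg fin])
  moreover have "(LINT x:{t..}|lborel. u' x) = (LINT x:{t<..}|lborel. u' x)"
  proof -
    have "{t..} = {t} \<union> {t<..}" by auto
    then have "(LINT x:{t..}|lborel. u' x) = (LINT x:{t}|lborel. u' x) + (LINT x:{t<..}|lborel. u' x)"
      using t by (simp only:) (intro set_integral_Un set_integrable_subset[OF u'], auto)
    moreover have "(LINT x:{t}|lborel. u' x) = 0"
      unfolding set_lebesgue_integral_def
      by (intro integral_eq_zero_AE eventually_mono[OF AE_lborel_singleton[of t]]) auto
    ultimately show ?thesis by simp
  qed
  ultimately show ?thesis by simp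
qed

section \<open>Uniqueness for the linear differential equation, and regularity\<close>

text \<open>
  By the quotient rule \<open>u / v\<close> has derivative \<open>0\<close> off \<open>K\<close>. Continuity at the points of \<open>K\<close> prevents the
  constant from changing from one component interval to the next.
\<close>

lemma same_log_derivative_imp_proportional:
  fixes u v :: "real \<Rightarrow> real"
  assumes K: "finite K" and pos: "\<And>x. L < x \<Longrightarrow> 0 < v x"
    and cont: "continuous_on {L<..} u" "continuous_on {L<..} v"
    and v: "\<And>x. x \<in> {L<..} - K \<Longrightarrow> (v has_real_derivative v' x) (at x)"
    and u: "\<And>x. x \<in> {L<..} - K \<Longrightarrow> (u has_real_derivative v' x / v x * u x) (at x)"
  obtains c where "\<And>x. L < x \<Longrightarrow> u x = c * v x"
proof
  fix x assume x: "L < x"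
  have "u x / v x = u (L + 1) / v (L + 1)"
  proof (rule has_derivative_zero_unique_strong_convex[OF _ K, of "{L<..}" "\<lambda>x. u x / v x" "L + 1"])
    show "continuous_on {L<..} (\<lambda>x. u x / v x)"
      using pos by (intro continuous_intros cont) force
    fix z assume z: "z \<in> {L<..} - K"
    have vz: "v z \<noteq> 0" using pos[of z] z by auto
    have "((\<lambda>x. u x / v x) has_real_derivative
            ((v' z / v z * u z) * v z - u z * v' z) / (v z * v z)) (at z)"
      using u[OF z] v[OF z] vz by (rule DERIV_divide)
    also have "((v' z / v z * u z) * v z - u z * v' z) / (v z * v z) = 0"
      using vz by simp
    finally show "((\<lambda>x. u x / v x) has_derivative (\<lambda>h. 0)) (at z within {L<..})"
      by (auto simp: has_field_derivative_def lambda_zero intro: has_derivative_at_withinI)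
  qed (use x in auto)
  then show "u x = u (L + 1) / v (L + 1) * v x"
    using pos[OF x] by (simp add: field_simps)
qed

text \<open>
  Components of an open set of reals are open, so continuous differentiability on each component is a
  local statement at every point of the set.
\<close>

lemma components_C1_imp_deriv:
  fixes p :: "real \<Rightarrow> real"
  assumes "open S" and C1: "\<And>C. C \<in> components S \<Longrightarrow> p C1_differentiable_on C" and x: "x \<in> S"
  shows "(p has_real_derivative deriv p x) (at x)" and "isCont (deriv p) x"
proof -
  obtain C where C: "C \<in> components S" "x \<in> C"
    using x Union_components[of S] by blast
  have "open C" using \<open>open S\<close> C(1) by (rule open_components)
  obtain D where D: "\<And>z. z \<in> C \<Longrightarrow> (p has_real_derivative D z) (at z)" "continuous_on C D"
    using C1[OF C(1)]
    by (auto simp: C1_differentiable_on_def has_real_derivative_iff_has_vector_derivative)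
  have eq: "deriv p z = D z" if "z \<in> C" for z
    using D(1)[OF that] by (rule DERIV_imp_deriv)
  show "(p has_real_derivative deriv p x) (at x)" using D(1)[OF C(2)] eq[OF C(2)] by simp
  have "continuous_on C (deriv p)" using D(2) eq by (simp cong: continuous_on_cong)
  then show "isCont (deriv p) x" using \<open>open C\<close> C(2) continuous_on_eq_continuous_at by blast
qed

text \<open>
  The values of \<open>g\<close> at the points of \<open>K\<close> are arbitrary, as those of \<open>deriv p\<close> are where \<open>p\<close> is not
  differentiable; changing finitely many values does not affect measurability.
\<close>

lemma borel_measurable_indicator_mult_off_finite:
  fixes g :: "real \<Rightarrow> real"
  assumes K: "finite K" and cont: "continuous_on ({L<..} - K) g"
  shows "(\<lambda>x. indicator {L<..} x * g x) \<in> borel_measurable borel"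
proof (rule measurable_discrete_difference)
  have "{L<..} - K \<in> sets borel"
    using K by (intro borel_open open_Diff finite_imp_closed) auto
  from borel_measurable_continuous_on_indicator[OF this cont]
  show "(\<lambda>x. indicator ({L<..} - K) x *\<^sub>R g x) \<in> borel_measurable borel" .
  show "countable K" using K by (rule countable_finite)
qed (auto split: split_indicator)

section \<open>Expectations as integrals against a density\<close>

text \<open>
  Since \<open>X\<close> takes values in \<open>(L, \<infinity>)\<close>, replacing \<open>\<psi>\<close> by \<open>0\<close> outside this interval does not change
  \<open>\<psi>(X)\<close>. The change of variables is applied to this truncation, which is why measurability is asked of
  the truncation and not of \<open>\<psi>\<close>.
\<close>

lemma expectation_tail_eq_integral:
  fixes f \<psi> :: "real \<Rightarrow> real"
  assumes X: "X \<in> space M \<rightarrow> {L<..}" and f: "has_Lebesgue_density M X f"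
    and \<psi>: "(\<lambda>x. indicator {L<..} x * \<psi> x) \<in> borel_measurable borel"
    and t: "L < t"
  shows "(LINT \<omega>|M. - \<psi> (X \<omega>) * indicat_real {t<..} (X \<omega>)) = - (LINT x:{t<..}|lborel. \<psi> x * f x)"
proof -
  let ?h = "\<lambda>x. - (indicator {L<..} x * \<psi> x) * indicat_real {t<..} x"
  have h: "?h \<in> borel_measurable lborel" using \<psi> by measurable
  have "(LINT \<omega>|M. - \<psi> (X \<omega>) * indicat_real {t<..} (X \<omega>)) = (LINT \<omega>|M. ?h (X \<omega>))"
    using X by (intro Bochner_Integration.integral_cong) (auto split: split_indicator)
  also have "\<dots> = (LINT x|lborel. f x * ?h x)"
    using f by (intro distributed_integral[symmetric] h) (auto simp: has_Lebesgue_density_def)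
  also have "\<dots> = (LINT x|lborel. - (indicator {t<..} x *\<^sub>R (\<psi> x * f x)))"
    using t by (intro Bochner_Integration.integral_cong) (auto split: split_indicator)
  finally show ?thesis by (simp add: set_lebesgue_integral_def)
qed

lemma density_integrable_of_expectation:
  fixes f \<psi> :: "real \<Rightarrow> real"
  assumes X: "X \<in> space M \<rightarrow> {L<..}" and f: "has_Lebesgue_density M X f"
    and \<psi>: "(\<lambda>x. indicator {L<..} x * \<psi> x) \<in> borel_measurable borel"
    and int: "integrable M (\<lambda>\<omega>. \<bar>\<psi> (X \<omega>)\<bar>)"
  shows "set_integrable lborel {L<..} (\<lambda>x. \<psi> x * f x)"
proof -
  let ?h = "\<lambda>x. indicator {L<..} x * \<psi> x"
  have D: "distributed M lborel X (\<lambda>x. ennreal (f x))" "\<And>x. 0 \<le> f x"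
    using f by (auto simp: has_Lebesgue_density_def)
  have h: "?h \<in> borel_measurable lborel" using \<psi> by simp
  have Xm: "X \<in> measurable M lborel" using D(1) by (rule distributed_measurable)
  have eq: "?h (X \<omega>) = \<psi> (X \<omega>)" if "\<omega> \<in> space M" for \<omega>
    using X that by (auto split: split_indicator)
  have m: "(\<lambda>\<omega>. ?h (X \<omega>)) \<in> borel_measurable M"
    using measurable_compose[OF Xm h] .
  have "integrable M (\<lambda>\<omega>. ?h (X \<omega>))"
    by (rule Bochner_Integration.integrable_bound[OF int m]) (auto simp: eq simp del: abs_mult)
  then have "integrable lborel (\<lambda>x. f x * ?h x)"
    using distributed_integrable[OF D(1) h] D(2) by blast
  then show ?thesis by (simp add: set_integrable_def mult_ac)
qed

text \<open>
  Left of \<open>L\<close>, \<open>p\<close> vanishes by assumption and \<open>f\<close> almost everywhere, because \<open>X\<close> takes no values there.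
  So \<open>f = c p\<close> holds almost everywhere, and \<open>c = 1\<close> because both have total mass \<open>1\<close>.
\<close>

lemma density_eqI_proportional:
  fixes f p :: "real \<Rightarrow> real"
  assumes M: "prob_space M" and X: "X \<in> space M \<rightarrow> {L<..}"
    and f: "has_Lebesgue_density M X f" and pdf: "is_pdf p"
    and p0: "\<And>x. x < L \<Longrightarrow> p x = 0" and c: "\<And>x. L < x \<Longrightarrow> f x = c * p x" and pos: "0 < p (L + 1)"
  shows "has_Lebesgue_density M X p"
proof -
  interpret prob_space M by (rule M)
  have f0: "\<And>x. 0 \<le> f x" and D: "distributed M lborel X (\<lambda>x. ennreal (f x))"
    using f by (auto simp: has_Lebesgue_density_def)
  have p: "\<And>x. 0 \<le> p x" "p \<in> borel_measurable borel" "(\<integral>\<^sup>+x. ennreal (p x) \<partial>lborel) = 1"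
    using pdf by (auto simp: is_pdf_def)
  note [measurable] = p(2) distributed_borel_measurable[OF D]
  have c0: "0 \<le> c"
    using f0[of "L + 1"] c[of "L + 1"] pos by (simp add: zero_le_mult_iff)
  have "(\<integral>\<^sup>+x. ennreal (f x) * indicator {..L} x \<partial>lborel) = emeasure M (X -` {..L} \<inter> space M)"
    using D by (intro distributed_emeasure[symmetric]) auto
  also have "X -` {..L} \<inter> space M = {}" using X by (force simp: Pi_iff not_le[symmetric])
  finally have "(\<integral>\<^sup>+x. ennreal (f x) * indicator {..L} x \<partial>lborel) = 0" by simp
  then have "AE x in lborel. ennreal (f x) * indicator {..L} x = 0"
    by (intro nn_integral_0_iff_AE[THEN iffD1]) auto
  then have AE: "AE x in lborel. ennreal (f x) = ennreal c * ennreal (p x)"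
    using AE_lborel_singleton[of L]
  proof eventually_elim
    case (elim x)
    then show ?case
      using c[of x] p0[of x] p(1)[of x] c0 by (cases "L < x") (auto simp: ennreal_mult)
  qed
  have "1 = (\<integral>\<^sup>+x. ennreal (f x) * indicator UNIV x \<partial>lborel)"
    using distributed_emeasure[OF D, of UNIV] emeasure_space_1 by simp
  also have "\<dots> = (\<integral>\<^sup>+x. ennreal c * ennreal (p x) \<partial>lborel)"
    using AE by (intro nn_integral_cong_AE) auto
  also have "\<dots> = ennreal c" using p(3) by (simp add: nn_integral_cmult)
  finally have "AE x in lborel. ennreal (f x) = ennreal (p x)"
    using AE by simp
  then have "density lborel (\<lambda>x. ennreal (f x)) = density lborel (\<lambda>x. ennreal (p x))"
    by (intro density_cong) auto
  then show ?thesis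
    using D p(1) by (auto simp: has_Lebesgue_density_def distributed_def)
qed

section \<open>The characterization\<close>

theorem theorem5p1:
  fixes L :: real and p :: "real \<Rightarrow> real" and m :: nat and y :: "nat \<Rightarrow> real"
    and M :: "'a measure" and X :: "'a \<Rightarrow> real"
  defines "P \<equiv> dist_fun L p"
    and "S \<equiv> reg_set L m y"
  assumes pdf: "is_pdf p"
    and supp: "fsupp p = {L..}"
    and cont: "continuous_on {L<..} p"
    and pos: "\<And>x. L < x \<Longrightarrow> 0 < p x"
    and y_gt: "\<And>i. i \<in> {1..m} \<Longrightarrow> L < y i"
    and y_mono: "strict_mono_on {1..m} y"
    and C1: "\<And>C. C \<in> components S \<Longrightarrow> p C1_differentiable_on C"
    and sup_bound: "bdd_above ((\<lambda>x. \<bar>deriv p x * min (P x) (1 - P x) / (p x)\<^sup>2\<bar>) ` S)"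
    and int_bound: "set_integrable lborel S (\<lambda>x. (1 + \<bar>x\<bar>) * \<bar>deriv p x\<bar>)"
    and lim_L: "((\<lambda>x. P x / p x) \<longlongrightarrow> 0) (at_right L)"
    and M: "prob_space M"
    and X_range: "X \<in> space M \<rightarrow> {L<..}"
    and X_dens: "\<exists>g. has_Lebesgue_density M X g"
    and X_int1: "integrable M (\<lambda>\<omega>. \<bar>deriv p (X \<omega>) / p (X \<omega>)\<bar>)"
    and X_int2: "integrable M (\<lambda>\<omega>. \<bar>deriv p (X \<omega>) / p (X \<omega>) * X \<omega>\<bar>)"
  shows "has_Lebesgue_density M X p \<longleftrightarrow>
    (\<exists>f. has_Lebesgue_density M X f \<and>
      (\<forall>t>L. f t = (LINT \<omega>|M. - (deriv p (X \<omega>) / p (X \<omega>)) * indicat_real {t<..} (X \<omega>))))"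
proof -
  define K where "K = y ` {1..m}"
  define \<psi> where "\<psi> = (\<lambda>x. deriv p x / p x)"
  have K: "finite K" by (simp add: K_def)
  have S: "S = {L<..} - K" by (simp add: S_def reg_set_def K_def)
  have "open S" unfolding S using K by (intro open_Diff finite_imp_closed) auto
  then have p': "(p has_real_derivative deriv p x) (at x)" "isCont (deriv p) x" if "x \<in> S" for x
    using components_C1_imp_deriv C1 that by blast+
  have psi_cont: "isCont \<psi> x" if "x \<in> S" for x
    unfolding \<psi>_def using pos[of x] that S cont p'[OF that]
    by (intro continuous_intros) (auto dest: DERIV_isCont)
  have psi_meas: "(\<lambda>x. indicator {L<..} x * \<psi> x) \<in> borel_measurable borel"
    using psi_cont
    by (intro borel_measurable_indicator_mult_off_finite[OF K])
       (auto simp: S intro: continuous_at_imp_continuous_on)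
  have tail: "(LINT \<omega>|M. - (deriv p (X \<omega>) / p (X \<omega>)) * indicat_real {t<..} (X \<omega>))
      = - (LINT x:{t<..}|lborel. \<psi> x * f x)" if "has_Lebesgue_density M X f" "L < t" for f t
    using expectation_tail_eq_integral[OF X_range that(1) psi_meas that(2)] by (simp add: \<psi>_def)
  have int: "set_integrable lborel {L<..} (\<lambda>x. \<psi> x * f x)" if "has_Lebesgue_density M X f" for f
    using X_int1 by (intro density_integrable_of_expectation[OF X_range that psi_meas]) (simp add: \<psi>_def)
  show ?thesis
  proof
    assume dens: "has_Lebesgue_density M X p"
    have "p t = - (LINT x:{t<..}|lborel. \<psi> x * p x)" if "L < t" for t
    proof (rule minus_tail_integral_deriv[OF _ _ cont K _ int[OF dens] that])
      show "0 \<le> p x" for x using pdf by (simp add: is_pdf_def)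
      show "(\<integral>\<^sup>+x. ennreal (p x) \<partial>lborel) < \<infinity>" using pdf by (simp add: is_pdf_def)
      show "(p has_real_derivative \<psi> x * p x) (at x)" if "x \<in> {L<..} - K" for x
        using p'(1)[of x] pos[of x] that by (simp add: S \<psi>_def)
    qed
    with dens tail[OF dens] show "\<exists>f. has_Lebesgue_density M X f \<and>
      (\<forall>t>L. f t = (LINT \<omega>|M. - (deriv p (X \<omega>) / p (X \<omega>)) * indicat_real {t<..} (X \<omega>)))"
      by (intro exI[of _ p]) simp
  next
    assume "\<exists>f. has_Lebesgue_density M X f \<and>
      (\<forall>t>L. f t = (LINT \<omega>|M. - (deriv p (X \<omega>) / p (X \<omega>)) * indicat_real {t<..} (X \<omega>)))"
    then obtain f where dens: "has_Lebesgue_density M X f"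
      and f: "\<And>t. L < t \<Longrightarrow> f t = - (LINT x:{t<..}|lborel. \<psi> x * f x)"
      using tail by metis
    \<comment> \<open>The integral equation makes its solution regular: first continuous, then differentiable off \<open>K\<close>.\<close>
    have f_cont: "continuous_on {L<..} f"
      by (rule continuous_on_eq[OF continuous_on_minus[OF tail_integral_continuous_on[OF int[OF dens]]]])
         (auto simp: f[symmetric])
    have f_deriv: "(f has_real_derivative deriv p x / p x * f x) (at x)" if x: "x \<in> {L<..} - K" for x
    proof -
      have "isCont f x" using f_cont x by (simp add: continuous_on_eq_continuous_at)
      then have "isCont (\<lambda>x. \<psi> x * f x) x"
        using psi_cont[of x] x S by (intro continuous_intros) auto
      then have "((\<lambda>t. - (LINT x:{t<..}|lborel. \<psi> x * f x)) has_real_derivative \<psi> x * f x) (at x)"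
        using DERIV_minus[OF tail_integral_has_derivative[OF int[OF dens]], of x] x by simp
      then have "(f has_real_derivative \<psi> x * f x) (at x)"
        by (rule has_field_derivative_transform_within_open[of _ _ _ "{L<..}"])
           (use x in \<open>auto simp: f[symmetric]\<close>)
      then show ?thesis by (simp add: \<psi>_def)
    qed
    obtain c where c: "\<And>x. L < x \<Longrightarrow> f x = c * p x"
      using same_log_derivative_imp_proportional[OF K pos f_cont cont p'(1) f_deriv] S by blast
    have "p x = 0" if "x < L" for x
      using supp closure_subset[of "{x. p x \<noteq> 0}"] that by (force simp: fsupp_def)
    with c pos show "has_Lebesgue_density M X p"
      by (intro density_eqI_proportional[OF M X_range dens pdf]) auto
  qed
qed

end
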